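(* There exists a quasiconformal map $f : \mathbb{R}^2 \to \mathbb{R}^2$ such that $BU(f) \neq \emptyset$.
   Context: A quasiconformal map $f:\mathbb{R}^2\to\mathbb{R}^2$ is a homeomorphism that is quasiregular, i.e. $f$ belongs to the Sobolev space $W^{1,2}_{\mathrm{loc}}(\mathbb{R}^2)$ and there is a constant $K\ge 1$ such that $|Df(x)|^2 \le K \det Df(x)$ for almost every $x$, where $|Df(x)|$ is the operator norm. The orbit of $x$ is the sequence $(f^n(x))_{n\ge 0}$ of images of $x$ under the iterates of $f$. The bungee set $BU(f)$ is the set of points of $\mathbb{R}^2$ whose orbit is neither bounded nor tends to infinity. *)

theory Defs
  imports "HOL-Analysis.Analysis"
begin

definition partial_deriv :: "2 \<Rightarrow> (real^2 \<Rightarrow> real) \<Rightarrow> real^2 \<Rightarrow> real" where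
  "partial_deriv j \<phi> x = frechet_derivative \<phi> (at x) (axis j 1)"

primrec C_k :: "nat \<Rightarrow> (real^2 \<Rightarrow> real) \<Rightarrow> bool" where
  "C_k 0 \<phi> \<longleftrightarrow> continuous_on UNIV \<phi>"
| "C_k (Suc k) \<phi> \<longleftrightarrow>
     (\<forall>x. \<phi> differentiable (at x)) \<and> (\<forall>j. C_k k (partial_deriv j \<phi>))"

definition test_function :: "(real^2 \<Rightarrow> real) \<Rightarrow> bool" where
  "test_function \<phi> \<longleftrightarrow> (\<forall>k. C_k k \<phi>) \<and> compact (closure {x. \<phi> x \<noteq> 0})"

definition L2_loc :: "(real^2 \<Rightarrow> 'a::euclidean_space) \<Rightarrow> bool" where
  "L2_loc g \<longleftrightarrow> g \<in> borel_measurable lebesgue \<and>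
     (\<forall>S. compact S \<longrightarrow> set_integrable lebesgue S (\<lambda>x. (norm (g x))\<^sup>2))"

text \<open>Row \<open>i\<close>, column \<open>j\<close> of \<open>D x\<close> is the weak partial derivative of the \<open>i\<close>-th component
  of \<open>f\<close> in direction \<open>j\<close>. The integrals are only meaningful for locally integrable \<open>f\<close> and \<open>D\<close>,
  since the Bochner integral of a non-integrable function is \<open>0\<close>;
  local square integrability is therefore imposed wherever this predicate is used.\<close>

definition weak_derivative :: "(real^2 \<Rightarrow> real^2) \<Rightarrow> (real^2 \<Rightarrow> real^2^2) \<Rightarrow> bool" where
  "weak_derivative f D \<longleftrightarrow>
     (\<forall>\<phi>. test_function \<phi> \<longrightarrow> (\<forall>i j.
        (\<integral>x. (f x $ i) * partial_deriv j \<phi> x \<partial>lebesgue) =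
        - (\<integral>x. (D x $ i $ j) * \<phi> x \<partial>lebesgue)))"

text \<open>\<open>f\<close> lies in \<open>W\<^sup>1\<^sup>,\<^sup>2\<close> locally, with weak derivative \<open>D\<close> (which is unique up to null sets).\<close>

definition W12_loc_with :: "(real^2 \<Rightarrow> real^2) \<Rightarrow> (real^2 \<Rightarrow> real^2^2) \<Rightarrow> bool" where
  "W12_loc_with f D \<longleftrightarrow> L2_loc f \<and> L2_loc D \<and> weak_derivative f D"

definition quasiregular :: "(real^2 \<Rightarrow> real^2) \<Rightarrow> bool" where
  "quasiregular f \<longleftrightarrow>
     (\<exists>D. W12_loc_with f D \<and>
        (\<exists>K\<ge>1. AE x in lebesgue. (onorm (\<lambda>v. D x *v v))\<^sup>2 \<le> K * det (D x)))"

definition quasiconformal :: "(real^2 \<Rightarrow> real^2) \<Rightarrow> bool" where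
  "quasiconformal f \<longleftrightarrow> (\<exists>g. homeomorphism UNIV UNIV f g) \<and> quasiregular f"

definition bungee_set :: "('a::real_normed_vector \<Rightarrow> 'a) \<Rightarrow> 'a set" where
  "bungee_set f =
     {x. \<not> bounded (range (\<lambda>n. (f ^^ n) x)) \<and>
         \<not> filterlim (\<lambda>n. (f ^^ n) x) at_infinity sequentially}"

end

theory Submission
  imports Defs
begin

text \<open>Consider \<open>f (x, y) = (y, h y - x)\<close> with \<open>h\<close> a 1-periodic triangle wave that has slope
  \<open>L = 37/6\<close> within distance \<open>1/4\<close> of the integers. It is an invertible Lipschitz map with Jacobian
  determinant \<open>1\<close>, hence quasiconformal. Its orbits are the pairs \<open>(x\<^sub>n, x\<^sub>n\<^sub>+\<^sub>1)\<close> with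
  \<open>x\<^sub>n\<^sub>+\<^sub>2 + x\<^sub>n = h x\<^sub>n\<^sub>+\<^sub>1\<close>. For \<open>x\<^sub>n = m\<^sub>n + \<epsilon>\<^sub>n\<close> with \<open>m\<^sub>n\<close> an integer and \<open>\<bar>\<epsilon>\<^sub>n\<bar> \<le> 1/4\<close> this is the
  hyperbolic linear recursion \<open>\<epsilon>\<^sub>n\<^sub>+\<^sub>2 - L \<epsilon>\<^sub>n\<^sub>+\<^sub>1 + \<epsilon>\<^sub>n = - (m\<^sub>n\<^sub>+\<^sub>2 + m\<^sub>n)\<close>, which has such a solution as
  soon as \<open>\<bar>m\<^sub>n\<^sub>+\<^sub>2 + m\<^sub>n\<bar> \<le> 1\<close>. So every such integer sequence \<open>m\<close> is shadowed by an orbit, and we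
  choose \<open>m\<close> to be unbounded with \<open>(m\<^sub>n, m\<^sub>n\<^sub>+\<^sub>1) = (0, 0)\<close> for infinitely many \<open>n\<close>.\<close>

subsection \<open>Weak derivatives of Lipschitz maps\<close>

lemma integrable_continuous_bounded_support:
  fixes \<psi> :: "'a::euclidean_space \<Rightarrow> real"
  assumes cont: "continuous_on UNIV \<psi>" and supp: "\<And>x. norm x > R \<Longrightarrow> \<psi> x = 0"
  shows "integrable lborel \<psi>"
proof -
  have "integrable lborel (\<lambda>x. indicator (cball 0 R) x *\<^sub>R \<psi> x)"
    by (rule borel_integrable_compact) (auto intro: continuous_on_subset[OF cont])
  moreover have "(\<lambda>x. indicator (cball 0 R) x *\<^sub>R \<psi> x) = \<psi>"
    using supp by (auto simp: fun_eq_iff indicator_def not_le)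
  ultimately show ?thesis by simp
qed

text \<open>Translation invariance of Lebesgue measure. The computation takes place in
  \<open>lborel\<close> and passes to the completion at the end, the integrand being Borel.\<close>

lemma integral_translate_diff_eq_0:
  fixes \<psi> :: "'a::euclidean_space \<Rightarrow> real"
  assumes cont: "continuous_on UNIV \<psi>" and supp: "\<And>x. norm x > R \<Longrightarrow> \<psi> x = 0"
  shows "(\<integral>x. \<psi> (x + h) - \<psi> x \<partial>lebesgue) = 0"
proof -
  have meas: "\<psi> \<in> borel_measurable borel"
    using cont by (rule borel_measurable_continuous_onI)
  have meas': "(\<lambda>x. \<psi> (h + x)) \<in> borel_measurable borel"
    by (intro borel_measurable_continuous_onI continuous_intros continuous_on_compose2[OF cont]) auto
  have int: "integrable lborel \<psi>"
    using cont supp by (rule integrable_continuous_bounded_support)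
  have "integrable (distr lborel borel ((+) h)) \<psi>"
    using int by (simp add: lborel_distr_plus)
  then have int': "integrable lborel (\<lambda>x. \<psi> (h + x))"
    using meas by (subst (asm) integrable_distr_eq) auto
  have "(\<integral>x. \<psi> x \<partial>distr lborel borel ((+) h)) = (\<integral>x. \<psi> (h + x) \<partial>lborel)"
    using meas by (intro integral_distr) auto
  then have "(\<integral>x. \<psi> (h + x) - \<psi> x \<partial>lborel) = 0"
    using int int' by (simp add: lborel_distr_plus)
  moreover have "(\<integral>x. \<psi> (h + x) - \<psi> x \<partial>lebesgue) = (\<integral>x. \<psi> (h + x) - \<psi> x \<partial>lborel)"
    by (intro integral_completion) (simp add: borel_measurable_diff meas meas')
  ultimately show ?thesis
    by (simp add: add.commute)
qed

text \<open>Difference quotients of \<open>u \<phi>\<close> have integral \<open>0\<close> by translation invariance, and the Lipschitz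
  bounds allow passing to the limit by dominated convergence; no Fubini argument is needed.\<close>

lemma integral_by_parts_lipschitz:
  fixes u \<phi> u' \<phi>' :: "'a::euclidean_space \<Rightarrow> real"
  assumes e: "norm e = 1"
    and u_lip: "\<And>x y. \<bar>u x - u y\<bar> \<le> L * norm (x - y)"
    and u_der: "AE x in lebesgue. ((\<lambda>t. u (x + t *\<^sub>R e)) has_real_derivative u' x) (at 0)"
    and u'_meas: "u' \<in> borel_measurable lebesgue"
    and \<phi>_cont: "continuous_on UNIV \<phi>" and \<phi>'_cont: "continuous_on UNIV \<phi>'"
    and \<phi>_der: "\<And>x t. ((\<lambda>t. \<phi> (x + t *\<^sub>R e)) has_real_derivative \<phi>' (x + t *\<^sub>R e)) (at t)"
    and \<phi>_supp: "\<And>x. norm x > R \<Longrightarrow> \<phi> x = 0"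
    and \<phi>'_supp: "\<And>x. norm x > R \<Longrightarrow> \<phi>' x = 0"
  shows "(\<integral>x. u x * \<phi>' x \<partial>lebesgue) = - (\<integral>x. u' x * \<phi> x \<partial>lebesgue)"
proof -
  \<comment> \<open>The extra \<open>1\<close> covers all shifts \<open>t n \<le> 1\<close>: for
    \<open>x\<close> outside \<open>C\<close>, both \<open>x\<close> and
    \<open>x + t n *\<^sub>R e\<close> have norm above \<open>R\<close>. The absolute value keeps
    \<open>0\<close> in \<open>C\<close> even for negative \<open>R\<close>.\<close>
  define C where "C = cball (0::'a) (\<bar>R\<bar> + 1)"
  have L0: "L \<ge> 0"
    using u_lip[of e 0] e by simp
  have u_cont: "continuous_on UNIV u"
    using u_lip L0 by (intro lipschitz_on_continuous_on[of L] lipschitz_onI)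
      (auto simp: dist_norm)
  have compC: "compact C" unfolding C_def by simp
  have "bounded (u ` C)" "bounded (\<phi> ` C)" "bounded (\<phi>' ` C)"
    using u_cont \<phi>_cont \<phi>'_cont compC
    by (meson compact_continuous_image compact_imp_bounded continuous_on_subset subset_UNIV)+
  then obtain Bu B\<phi> B\<phi>' where
    Bu: "\<And>x. x \<in> C \<Longrightarrow> \<bar>u x\<bar> \<le> Bu" and B\<phi>C: "\<And>x. x \<in> C \<Longrightarrow> \<bar>\<phi> x\<bar> \<le> B\<phi>"
    and B\<phi>'C: "\<And>x. x \<in> C \<Longrightarrow> \<bar>\<phi>' x\<bar> \<le> B\<phi>'"
    unfolding bounded_iff by fastforce
  have zC: "0 \<in> C" unfolding C_def by simp
  have nn: "0 \<le> Bu" "0 \<le> B\<phi>" "0 \<le> B\<phi>'"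
    using Bu[OF zC] B\<phi>C[OF zC] B\<phi>'C[OF zC] by linarith+
  have B\<phi>: "\<bar>\<phi> x\<bar> \<le> B\<phi>" for x
    using B\<phi>C[of x] \<phi>_supp[of x] nn unfolding C_def by (cases "x \<in> C") (auto simp: C_def)
  have B\<phi>': "\<bar>\<phi>' x\<bar> \<le> B\<phi>'" for x
    using B\<phi>'C[of x] \<phi>'_supp[of x] nn unfolding C_def by (cases "x \<in> C") (auto simp: C_def)
  have \<phi>_lip: "\<bar>\<phi> (x + t *\<^sub>R e) - \<phi> x\<bar> \<le> B\<phi>' * t" if "t > 0" for x t
  proof -
    obtain z where "\<phi> (x + t *\<^sub>R e) - \<phi> (x + 0 *\<^sub>R e) = (t - 0) * \<phi>' (x + z *\<^sub>R e)"
      using MVT2[OF \<open>t > 0\<close>, of "\<lambda>t. \<phi> (x + t *\<^sub>R e)" "\<lambda>t. \<phi>' (x + t *\<^sub>R e)"] \<phi>_der by blast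
    then show ?thesis
      using B\<phi>'[of "x + z *\<^sub>R e"] that by (simp add: abs_mult mult.commute)
  qed
  define \<psi> where "\<psi> x = u x * \<phi> x" for x
  have \<psi>_cont: "continuous_on UNIV \<psi>"
    unfolding \<psi>_def using u_cont \<phi>_cont by (intro continuous_intros)
  have \<psi>_supp: "\<psi> x = 0" if "norm x > R" for x
    using \<phi>_supp[OF that] by (simp add: \<psi>_def)
  define t :: "nat \<Rightarrow> real" where "t n = 1 / real (Suc n)" for n
  have t: "t n > 0" "t n \<le> 1" for n by (auto simp: t_def)
  have t_lim: "filterlim t (at 0) sequentially"
  proof -
    have "t \<longlonglongrightarrow> 0" unfolding t_def by (rule LIMSEQ_Suc[OF lim_1_over_n])
    then show ?thesis
      using t(1) by (auto simp: filterlim_at less_imp_neq[symmetric] intro!: always_eventually)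
  qed
  define q where "q n x = (\<psi> (x + t n *\<^sub>R e) - \<psi> x) / t n" for n x
  have q_int: "integral\<^sup>L lebesgue (q n) = 0" for n
    using integral_translate_diff_eq_0[OF \<psi>_cont \<psi>_supp, where h = "t n *\<^sub>R e"]
    unfolding q_def by simp
  define w where "w x = (B\<phi> * L + Bu * B\<phi>') * indicator C x" for x :: 'a
  have w_int: "integrable lebesgue w"
  proof -
    have "integrable lborel w"
      unfolding w_def using compC emeasure_lborel_cball_finite[of 0 "\<bar>R\<bar> + 1"]
      by (auto simp: C_def)
    then show ?thesis
      by (subst integrable_completion) auto
  qed
  have q_bound: "norm (q n x) \<le> w x" for n x
  proof (cases "x \<in> C")
    case True
    \<comment> \<open>Discrete product rule, arranged so that the bare factor \<open>u\<close> is
      taken at \<open>x \<in> C\<close>, where \<open>Bu\<close> bounds it. The shifted point enters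
      only through the globally bounded \<open>\<phi>\<close> and through Lipschitz
      increments.\<close>
    have "\<psi> (x + t n *\<^sub>R e) - \<psi> x = \<phi> (x + t n *\<^sub>R e) * (u (x + t n *\<^sub>R e) - u x)
        + u x * (\<phi> (x + t n *\<^sub>R e) - \<phi> x)"
      unfolding \<psi>_def by algebra
    moreover have "\<bar>\<phi> (x + t n *\<^sub>R e) * (u (x + t n *\<^sub>R e) - u x)\<bar> \<le> B\<phi> * (L * t n)"
      using u_lip[of "x + t n *\<^sub>R e" x] e t(1)[of n] nn B\<phi> unfolding abs_mult
      by (intro mult_mono) auto
    moreover have "\<bar>u x * (\<phi> (x + t n *\<^sub>R e) - \<phi> x)\<bar> \<le> Bu * (B\<phi>' * t n)"
      using \<phi>_lip[OF t(1)[of n]] nn Bu[OF True] unfolding abs_mult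
      by (intro mult_mono) auto
    ultimately have "\<bar>\<psi> (x + t n *\<^sub>R e) - \<psi> x\<bar> \<le> (B\<phi> * L + Bu * B\<phi>') * t n"
      by (simp add: algebra_simps)
    then show ?thesis
      using True t(1)[of n] by (simp add: q_def w_def abs_divide pos_divide_le_eq)
  next
    case False
    then have big: "norm x > \<bar>R\<bar> + 1" by (simp add: C_def)
    have "norm x \<le> norm (x + t n *\<^sub>R e) + norm (t n *\<^sub>R e)"
      using norm_triangle_ineq4[of "x + t n *\<^sub>R e" "t n *\<^sub>R e"] by simp
    then have "norm (x + t n *\<^sub>R e) > R"
      using big t[of n] e by simp
    then show ?thesis
      using big False \<psi>_supp[of x] \<psi>_supp[of "x + t n *\<^sub>R e"] by (simp add: q_def w_def)
  qed
  have q_lim: "AE x in lebesgue. (\<lambda>n. q n x) \<longlonglongrightarrow> u' x * \<phi> x + u x * \<phi>' x"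
    using u_der
  proof eventually_elim
    case (elim x)
    have "((\<lambda>t. \<psi> (x + t *\<^sub>R e)) has_real_derivative
        u' x * \<phi> (x + 0 *\<^sub>R e) + \<phi>' (x + 0 *\<^sub>R e) * u (x + 0 *\<^sub>R e)) (at 0)"
      unfolding \<psi>_def using elim \<phi>_der by (rule DERIV_mult)
    then have "((\<lambda>t. (\<psi> (x + t *\<^sub>R e) - \<psi> x) / t) \<longlongrightarrow> u' x * \<phi> x + u x * \<phi>' x) (at 0)"
      by (simp add: has_field_derivative_iff mult.commute)
    from filterlim_compose[OF this t_lim] show ?case
      unfolding q_def .
  qed
  have cont_meas: "f \<in> borel_measurable lebesgue" if "continuous_on UNIV f" for f :: "'a \<Rightarrow> real"
    using that by (simp add: borel_measurable_continuous_onI measurable_completion)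
  have lim_meas: "(\<lambda>x. u' x * \<phi> x + u x * \<phi>' x) \<in> borel_measurable lebesgue"
    using u'_meas cont_meas[OF u_cont] cont_meas[OF \<phi>_cont] cont_meas[OF \<phi>'_cont] by measurable
  have q_meas: "q n \<in> borel_measurable lebesgue" for n
    unfolding q_def using t(1)[of n]
    by (intro cont_meas continuous_intros continuous_on_compose2[OF \<psi>_cont]) auto
  have sum_int: "integrable lebesgue (\<lambda>x. u' x * \<phi> x + u x * \<phi>' x)"
    by (rule integrable_dominated_convergence[OF lim_meas q_meas w_int q_lim]) (intro AE_I2 q_bound)
  have "(\<lambda>n. integral\<^sup>L lebesgue (q n)) \<longlonglongrightarrow> (\<integral>x. u' x * \<phi> x + u x * \<phi>' x \<partial>lebesgue)"
    by (rule integral_dominated_convergence[OF lim_meas q_meas w_int q_lim]) (intro AE_I2 q_bound)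
  then have zero: "(\<integral>x. u' x * \<phi> x + u x * \<phi>' x \<partial>lebesgue) = 0"
    by (simp add: q_int LIMSEQ_const_iff)
  have "integrable lborel (\<lambda>x. u x * \<phi>' x)"
    using u_cont \<phi>'_cont \<phi>'_supp
    by (intro integrable_continuous_bounded_support[where R = R] continuous_intros) auto
  then have int2: "integrable lebesgue (\<lambda>x. u x * \<phi>' x)"
    by (subst integrable_completion) auto
  \<comment> \<open>With no bound on \<open>u'\<close> at hand, this integrability comes from that
    of the dominated limit \<open>sum_int\<close>.\<close>
  have int1: "integrable lebesgue (\<lambda>x. u' x * \<phi> x)"
    using Bochner_Integration.integrable_diff[OF sum_int int2] by simp
  show ?thesis
    using zero int1 int2 by simp
qed

section \<open>Test functions and almost everywhere derivatives\<close>

lemma has_derivative_imp_line_derivative: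
  fixes g :: "'a::real_normed_vector \<Rightarrow> real"
  assumes "(g has_derivative g') (at (x + t *\<^sub>R e))"
  shows "((\<lambda>t. g (x + t *\<^sub>R e)) has_real_derivative g' e) (at t)"
proof -
  have "((\<lambda>t. g (x + t *\<^sub>R e)) has_derivative (\<lambda>s. g' (s *\<^sub>R e))) (at t)"
    by (rule has_derivative_compose[where f = "\<lambda>t. x + t *\<^sub>R e" and g = g])
      (auto intro!: derivative_eq_intros assms)
  moreover have "g' (s *\<^sub>R e) = g' e * s" for s
    using linear_scale[OF has_derivative_linear[OF assms]] by simp
  ultimately show ?thesis
    by (simp add: has_field_derivative_def)
qed

lemma test_functionD:
  assumes "test_function \<phi>"
  shows "continuous_on UNIV \<phi>"
    and "continuous_on UNIV (partial_deriv j \<phi>)"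
    and "((\<lambda>t. \<phi> (x + t *\<^sub>R axis j 1)) has_real_derivative partial_deriv j \<phi> (x + t *\<^sub>R axis j 1)) (at t)"
proof -
  have "C_k 0 \<phi>" "C_k 1 \<phi>"
    using assms unfolding test_function_def by blast+
  then show "continuous_on UNIV \<phi>" "continuous_on UNIV (partial_deriv j \<phi>)"
    by auto
  have "\<phi> differentiable (at (x + t *\<^sub>R axis j 1))"
    using \<open>C_k 1 \<phi>\<close> by simp
  then show "((\<lambda>t. \<phi> (x + t *\<^sub>R axis j 1)) has_real_derivative partial_deriv j \<phi> (x + t *\<^sub>R axis j 1)) (at t)"
    unfolding partial_deriv_def frechet_derivative_works by (rule has_derivative_imp_line_derivative)
qed

lemma test_function_support:
  assumes "test_function \<phi>"
  obtains R where "\<And>x. norm x > R \<Longrightarrow> \<phi> x = 0" "\<And>x j. norm x > R \<Longrightarrow> partial_deriv j \<phi> x = 0"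
proof -
  have "bounded (closure {x. \<phi> x \<noteq> 0})"
    using assms by (simp add: test_function_def compact_imp_bounded)
  then obtain R where R: "\<And>x. x \<in> closure {x. \<phi> x \<noteq> 0} \<Longrightarrow> norm x \<le> R"
    unfolding bounded_iff by blast
  have zero: "\<phi> x = 0" if "norm x > R" for x
    using R[of x] closure_subset[of "{x. \<phi> x \<noteq> 0}"] that by fastforce
  have "partial_deriv j \<phi> x = 0" if "norm x > R" for x j
  proof -
    have "open (- cball (0::real^2) R)" "x \<in> - cball 0 R"
      using that by auto
    then have "(\<phi> has_derivative (\<lambda>v. 0)) (at x)"
      using zero by (intro has_derivative_transform_within_open[OF has_derivative_const[of 0]]) auto
    then show ?thesis
      unfolding partial_deriv_def by (simp add: frechet_derivative_at[symmetric])
  qed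
  with zero show thesis by (intro that[of R])
qed

lemma weak_derivative_lipschitz:
  fixes f :: "real^2 \<Rightarrow> real^2"
  assumes lip: "L-lipschitz_on UNIV f"
    and der: "AE x in lebesgue. (f has_derivative (\<lambda>v. D x *v v)) (at x)"
    and meas: "D \<in> borel_measurable lebesgue"
  shows "weak_derivative f D"
  unfolding weak_derivative_def
proof (intro allI impI)
  fix \<phi> i j
  assume \<phi>: "test_function \<phi>"
  obtain R where R: "\<And>x. norm x > R \<Longrightarrow> \<phi> x = 0" "\<And>x j. norm x > R \<Longrightarrow> partial_deriv j \<phi> x = 0"
    using test_function_support[OF \<phi>] by blast
  show "(\<integral>x. f x $ i * partial_deriv j \<phi> x \<partial>lebesgue) = - (\<integral>x. D x $ i $ j * \<phi> x \<partial>lebesgue)"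
  proof (rule integral_by_parts_lipschitz[where e = "axis j 1" and L = L and R = R])
    show "\<bar>f x $ i - f y $ i\<bar> \<le> L * norm (x - y)" for x y
      using component_le_norm_cart[of "f x - f y" i] lipschitz_onD[OF lip, of x y]
      by (simp add: dist_norm)
    show "AE x in lebesgue. ((\<lambda>t. f (x + t *\<^sub>R axis j 1) $ i) has_real_derivative D x $ i $ j) (at 0)"
      using der
    proof eventually_elim
      case (elim x)
      have "((\<lambda>x. f x $ i) has_derivative (\<lambda>v. (D x *v v) $ i)) (at x)"
        using bounded_linear_vec_nth elim by (rule bounded_linear.has_derivative)
      then show ?case
        using has_derivative_imp_line_derivative[of "\<lambda>x. f x $ i" "\<lambda>v. (D x *v v) $ i" x 0 "axis j 1"]
        by (simp add: matrix_vector_mult_basis column_def)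
    qed
    have "(\<lambda>x. D x \<bullet> axis i (axis j 1)) \<in> borel_measurable lebesgue"
      using meas by measurable
    then show "(\<lambda>x. D x $ i $ j) \<in> borel_measurable lebesgue"
      by (simp add: inner_axis)
  qed (use \<phi> R test_functionD in auto)
qed

section \<open>Local Sobolev regularity\<close>

lemma L2_loc_locally_bounded:
  fixes g :: "real^2 \<Rightarrow> 'a::euclidean_space"
  assumes meas: "g \<in> borel_measurable lebesgue"
    and bdd: "\<And>S. compact S \<Longrightarrow> bounded (g ` S)"
  shows "L2_loc g"
  unfolding L2_loc_def
proof (intro conjI allI impI meas)
  fix S :: "(real^2) set"
  assume S: "compact S"
  from bdd[OF S] obtain B where B: "\<And>x. x \<in> S \<Longrightarrow> norm (g x) \<le> B"
    unfolding bounded_iff by blast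
  show "set_integrable lebesgue S (\<lambda>x. (norm (g x))\<^sup>2)"
    unfolding set_integrable_def
  proof (rule Bochner_Integration.integrable_bound)
    show "integrable lebesgue (\<lambda>x. B\<^sup>2 * indicator S x)"
      using lmeasurable_compact[OF S] by (simp add: lmeasurable_iff_integrable)
    show "(\<lambda>x. indicator S x *\<^sub>R (norm (g x))\<^sup>2) \<in> borel_measurable lebesgue"
      using meas fmeasurableD[OF lmeasurable_compact[OF S]] by simp
    show "AE x in lebesgue. norm (indicator S x *\<^sub>R (norm (g x))\<^sup>2) \<le> norm (B\<^sup>2 * indicator S x)"
      using B by (auto simp: indicator_def intro!: AE_I2 power_mono)
  qed
qed

text \<open>Reduces Sobolev membership to pointwise work: a bounded, measurable classical derivative
  outside a null set suffices.\<close>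

lemma W12_loc_with_lipschitz:
  fixes f :: "real^2 \<Rightarrow> real^2"
  assumes lip: "L-lipschitz_on UNIV f"
    and der: "AE x in lebesgue. (f has_derivative (\<lambda>v. D x *v v)) (at x)"
    and meas: "D \<in> borel_measurable lebesgue"
    and bdd: "bounded (range D)"
  shows "W12_loc_with f D"
  unfolding W12_loc_with_def
proof (intro conjI L2_loc_locally_bounded meas)
  have cont: "continuous_on UNIV f"
    using lip by (rule lipschitz_on_continuous_on)
  then show "f \<in> borel_measurable lebesgue"
    by (simp add: borel_measurable_continuous_onI measurable_completion)
  show "bounded (f ` S)" if "compact S" for S
    using that cont by (meson compact_continuous_image compact_imp_bounded continuous_on_subset subset_UNIV)
  show "bounded (D ` S)" for S
    using bdd by (rule bounded_subset) auto
  show "weak_derivative f D"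
    using lip der meas by (rule weak_derivative_lipschitz)
qed

subsection \<open>A quasiconformal map driven by a triangle wave\<close>

text \<open>Distance to the nearest integer, shifted to be the identity on
  \<open>[-1/4, 1/4]\<close>. With \<open>infdist\<close>, continuity and the Lipschitz bound are
  immediate.\<close>

definition triangle_wave :: "real \<Rightarrow> real" where
  "triangle_wave x = infdist (x + 1/4) \<int> - 1/4"

text \<open>At the corners, where \<open>2 * (x + 1/4)\<close> is an integer, the value is a
  convention: the wave has no derivative there.\<close>

definition triangle_slope :: "real \<Rightarrow> real" where
  "triangle_slope x = (if frac (x + 1/4) < 1/2 then 1 else -1)"

lemma infdist_Ints:
  fixes y :: real
  shows "infdist y \<int> = min (frac y) (1 - frac y)"
proof (rule antisym)
  have "infdist y \<int> \<le> dist y (of_int \<lfloor>y\<rfloor>)" "infdist y \<int> \<le> dist y (of_int (\<lfloor>y\<rfloor> + 1))"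
    by (rule infdist_le; simp)+
  then show "infdist y \<int> \<le> min (frac y) (1 - frac y)"
    unfolding dist_real_def frac_def by linarith
  have "min (frac y) (1 - frac y) \<le> dist y a" if "a \<in> \<int>" for a
  proof -
    obtain k where k: "a = of_int k" using \<open>a \<in> \<int>\<close> by (rule Ints_cases)
    have "k \<le> \<lfloor>y\<rfloor> \<or> k \<ge> \<lfloor>y\<rfloor> + 1" by linarith
    then have "a \<le> of_int \<lfloor>y\<rfloor> \<or> a \<ge> of_int (\<lfloor>y\<rfloor> + 1)"
      unfolding k of_int_le_iff .
    then show ?thesis
      unfolding dist_real_def frac_def by auto
  qed
  moreover have "(\<int> :: real set) \<noteq> {}" by auto
  ultimately show "min (frac y) (1 - frac y) \<le> infdist y \<int>"
    by (simp add: infdist_notempty cINF_greatest)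
qed

lemma triangle_wave_lipschitz: "\<bar>triangle_wave x - triangle_wave y\<bar> \<le> \<bar>x - y\<bar>"
  using infdist_triangle_abs[of "x + 1/4" \<int> "y + 1/4"]
  by (simp add: triangle_wave_def dist_real_def)

text \<open>Here the nonlinear recursion becomes linear: where \<open>frac\<close> is at most
  \<open>1/2\<close>, the distance to the integers is \<open>frac\<close> itself. The endpoint
  \<open>e = 1/4\<close> is a corner, at which both linear pieces agree.\<close>

lemma triangle_wave_near_Ints:
  assumes "m \<in> \<int>" "\<bar>e\<bar> \<le> 1/4"
  shows "triangle_wave (m + e) = e"
proof -
  obtain k where k: "m = of_int k" using \<open>m \<in> \<int>\<close> by (rule Ints_cases)
  have "frac (m + e + 1/4) = e + 1/4"
    using assms(2) unfolding k frac_unique_iff by auto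
  then show ?thesis
    using assms(2) by (simp add: triangle_wave_def infdist_Ints)
qed

lemma triangle_wave_has_derivative:
  assumes "2 * (x + 1/4) \<notin> \<int>"
  shows "(triangle_wave has_real_derivative triangle_slope x) (at x)"
proof -
  \<comment> \<open>The left end of the period containing \<open>x\<close>; the corners in
    \<open>[n, n + 1)\<close> are \<open>n\<close> and \<open>n + 1/2\<close>, excluded by the
    hypothesis.\<close>
  define n where "n = of_int \<lfloor>x + 1/4\<rfloor> - (1/4 :: real)"
  have n: "n \<le> x" "x < n + 1" unfolding n_def by linarith+
  have fr: "frac (y + 1/4) = y - n" if "n \<le> y" "y < n + 1" for y
    using that unfolding n_def frac_unique_iff by auto
  have "x \<noteq> n" "x \<noteq> n + 1/2"
  proof -
    have "2 * (x + 1/4) = of_int (2 * \<lfloor>x + 1/4\<rfloor>)" if "x = n"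
      using that by (simp add: n_def)
    then show "x \<noteq> n"
      using assms Ints_of_int by metis
    have "2 * (x + 1/4) = of_int (2 * \<lfloor>x + 1/4\<rfloor> + 1)" if "x = n + 1/2"
      using that by (simp add: n_def)
    then show "x \<noteq> n + 1/2"
      using assms Ints_of_int by metis
  qed
  then consider "x \<in> {n<..<n+1/2}" | "x \<in> {n+1/2<..<n+1}"
    using n by fastforce
  then show ?thesis
  proof cases
    case 1
    then have "triangle_slope x = 1"
      by (simp add: triangle_slope_def fr)
    moreover have "((\<lambda>y. y - n - 1/4) has_real_derivative 1) (at x)"
      by (auto intro!: derivative_eq_intros)
    then have "(triangle_wave has_real_derivative 1) (at x)"
      using 1 by (elim has_field_derivative_transform_within_open[OF _ open_greaterThanLessThan])
        (auto simp: triangle_wave_def infdist_Ints fr)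
    ultimately show ?thesis by simp
  next
    case 2
    then have "triangle_slope x = -1"
      by (simp add: triangle_slope_def fr)
    moreover have "((\<lambda>y. n + 3/4 - y) has_real_derivative -1) (at x)"
      by (auto intro!: derivative_eq_intros)
    then have "(triangle_wave has_real_derivative -1) (at x)"
      using 2 by (elim has_field_derivative_transform_within_open[OF _ open_greaterThanLessThan])
        (auto simp: triangle_wave_def infdist_Ints fr)
    ultimately show ?thesis by simp
  qed
qed

lemma triangle_slope_measurable: "triangle_slope \<in> borel_measurable borel"
  unfolding triangle_slope_def frac_def by measurable

text \<open>The corners of the wave fill only countably many horizontal lines, each a null
  set.\<close>

lemma AE_half_integers_avoided: "AE x::real^2 in lebesgue. 2 * (x $ 2 + 1/4) \<notin> \<int>"
proof -
  have "negligible (\<Union>k::int. {x::real^2. x $ 2 = of_int k / 2 - 1/4})"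
    using negligible_hyperplane[of "axis 2 1 :: real^2"]
    by (intro negligible_countable_Union) (auto simp: inner_axis' axis_eq_0_iff)
  then have "AE x::real^2 in lebesgue. x \<notin> (\<Union>k::int. {x::real^2. x $ 2 = of_int k / 2 - 1/4})"
    unfolding negligible_iff_null_sets by (rule AE_not_in)
  then show ?thesis
  proof eventually_elim
    case (elim x)
    show ?case
    proof
      assume "2 * (x $ 2 + 1/4) \<in> \<int>"
      then obtain k where "2 * (x $ 2 + 1/4) = of_int k" by (rule Ints_cases)
      then have "x $ 2 = of_int k / 2 - 1/4" by simp
      with elim show False by blast
    qed
  qed
qed

section \<open>The map, its derivative and its inverse\<close>

text \<open>A map of Henon type with a triangle wave as nonlinearity. Where the wave has slope
  \<open>1\<close>, the derivative has determinant \<open>1\<close> and trace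
  \<open>37/6 = 6 + 1/6\<close>, hence eigenvalues \<open>6\<close> and \<open>1/6\<close>.\<close>

definition bungee_map :: "real^2 \<Rightarrow> real^2" where
  "bungee_map x = vector [x $ 2, 37/6 * triangle_wave (x $ 2) - x $ 1]"

definition bungee_deriv :: "real^2 \<Rightarrow> real^2^2" where
  "bungee_deriv x = vector [vector [0, 1], vector [-1, 37/6 * triangle_slope (x $ 2)]]"

lemma bungee_map_lipschitz: "10-lipschitz_on UNIV bungee_map"
proof (rule lipschitz_onI)
  fix x y :: "real^2"
  have "norm (bungee_map x - bungee_map y) \<le> (\<Sum>i\<in>UNIV. \<bar>(bungee_map x - bungee_map y) $ i\<bar>)"
    by (rule norm_le_l1_cart)
  also have "\<dots> = \<bar>x $ 2 - y $ 2\<bar> +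
      \<bar>37/6 * (triangle_wave (x $ 2) - triangle_wave (y $ 2)) - (x $ 1 - y $ 1)\<bar>"
    by (simp add: sum_2 bungee_map_def algebra_simps)
  also have "\<dots> \<le> \<bar>x $ 2 - y $ 2\<bar> + (37/6 * \<bar>x $ 2 - y $ 2\<bar> + \<bar>x $ 1 - y $ 1\<bar>)"
    using triangle_wave_lipschitz[of "x $ 2" "y $ 2"]
      abs_triangle_ineq4[of "37/6 * (triangle_wave (x $ 2) - triangle_wave (y $ 2))" "x $ 1 - y $ 1"]
    unfolding abs_mult by simp
  also have "\<dots> \<le> norm (x - y) + (37/6 * norm (x - y) + norm (x - y))"
    using component_le_norm_cart[of "x - y"] unfolding vector_minus_component
    by (intro add_mono mult_left_mono) auto
  \<comment> \<open>The exact sum of the coefficients is \<open>49/6\<close>.\<close>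
  also have "\<dots> \<le> 10 * norm (x - y)"
    by simp
  finally show "dist (bungee_map x) (bungee_map y) \<le> 10 * dist x y"
    by (simp add: dist_norm)
qed simp

lemma bungee_map_has_derivative:
  assumes "2 * (x $ 2 + 1/4) \<notin> \<int>"
  shows "(bungee_map has_derivative (\<lambda>v. bungee_deriv x *v v)) (at x)"
proof -
  have "((\<lambda>x::real^2. triangle_wave (x $ 2)) has_derivative (\<lambda>v. triangle_slope (x $ 2) * v $ 2)) (at x)"
    using triangle_wave_has_derivative[OF assms] unfolding has_field_derivative_def
    by (rule has_derivative_compose[rotated]) (auto intro: bounded_linear_imp_has_derivative)
  then have second: "((\<lambda>x::real^2. 37/6 * triangle_wave (x $ 2) - x $ 1) has_derivative
      (\<lambda>v. 37/6 * (triangle_slope (x $ 2) * v $ 2) - v $ 1)) (at x)"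
    by (intro has_derivative_diff has_derivative_mult_right bounded_linear_imp_has_derivative) auto
  have "((\<lambda>x. bungee_map x $ i) has_derivative (\<lambda>v. (bungee_deriv x *v v) $ i)) (at x)" for i
  proof (cases "i = 1")
    case True
    then show ?thesis
      by (simp add: bungee_map_def bungee_deriv_def matrix_vector_mult_def sum_2
          bounded_linear_imp_has_derivative[OF bounded_linear_vec_nth])
  next
    case False
    then have "i = 2" using exhaust_2[of i] by blast
    moreover have "(\<lambda>v. (bungee_deriv x *v v) $ 2) = (\<lambda>v. 37/6 * (triangle_slope (x $ 2) * v $ 2) - v $ 1)"
      by (simp add: fun_eq_iff bungee_deriv_def matrix_vector_mult_def sum_2)
    ultimately show ?thesis
      using second by (simp add: bungee_map_def)
  qed
  then show ?thesis
    by (subst has_derivative_componentwise_within) (auto simp: Basis_vec_def inner_axis)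
qed

lemma bungee_deriv_entry: "\<bar>bungee_deriv x $ i $ j\<bar> \<le> 37/6"
  using exhaust_2[of i] exhaust_2[of j] by (auto simp: bungee_deriv_def triangle_slope_def)

lemma bungee_deriv_measurable: "bungee_deriv \<in> borel_measurable lebesgue"
proof -
  have "bungee_deriv = (\<lambda>x. vector [vector [0, 1], vector [-1, 0]] +
      (37/6 * triangle_slope (x $ 2)) *\<^sub>R vector [vector [0, 0], vector [0, 1]])"
    by (simp add: fun_eq_iff vec_eq_iff forall_2 bungee_deriv_def)
  moreover have "\<dots> \<in> borel_measurable borel"
    by (intro borel_measurable_add borel_measurable_scaleR borel_measurable_times borel_measurable_const
        measurable_compose[OF _ triangle_slope_measurable])
      (auto intro!: borel_measurable_continuous_onI continuous_intros)
  ultimately show ?thesis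
    by (simp add: measurable_completion)
qed

lemma bungee_map_quasiregular: "quasiregular bungee_map"
  unfolding quasiregular_def
proof (intro exI conjI)
  \<comment> \<open>\<open>74/3 = 4 * 37/6\<close>: four entries, each at most \<open>37/6\<close>
    in absolute value.\<close>
  have onorm: "onorm (\<lambda>v. bungee_deriv x *v v) \<le> 74/3" for x
    using onorm_le_matrix_component[of "bungee_deriv x" "37/6"] bungee_deriv_entry by simp
  have "norm (bungee_deriv x) \<le> 74/3" for x
  proof -
    have "norm (bungee_deriv x) \<le> (\<Sum>i\<in>UNIV. norm (bungee_deriv x $ i))"
      unfolding norm_vec_def by (rule L2_set_le_sum) simp
    also have "\<dots> \<le> (\<Sum>i\<in>UNIV. \<Sum>j\<in>UNIV. \<bar>bungee_deriv x $ i $ j\<bar>)"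
      by (intro sum_mono norm_le_l1_cart)
    also have "\<dots> \<le> 74/3"
      using bungee_deriv_entry[of x 1 1] bungee_deriv_entry[of x 1 2]
        bungee_deriv_entry[of x 2 1] bungee_deriv_entry[of x 2 2] by (simp add: sum_2)
    finally show ?thesis .
  qed
  then have "bounded (range bungee_deriv)"
    unfolding bounded_iff by blast
  moreover have "AE x in lebesgue. (bungee_map has_derivative (\<lambda>v. bungee_deriv x *v v)) (at x)"
    using AE_half_integers_avoided by eventually_elim (rule bungee_map_has_derivative)
  ultimately show "W12_loc_with bungee_map bungee_deriv"
    by (intro W12_loc_with_lipschitz[OF bungee_map_lipschitz] bungee_deriv_measurable)
  \<comment> \<open>With determinant \<open>1\<close>, any uniform bound on the squared operator
    norm serves as \<open>K\<close>.\<close>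
  have "det (bungee_deriv x) = 1" for x
    by (simp add: det_2 bungee_deriv_def)
  moreover have "(onorm (\<lambda>v. bungee_deriv x *v v))\<^sup>2 \<le> (74/3)\<^sup>2" for x
    using onorm by (intro power_mono onorm_pos_le matrix_vector_mul_bounded_linear)
  ultimately show "AE x in lebesgue. (onorm (\<lambda>v. bungee_deriv x *v v))\<^sup>2 \<le> (74/3)\<^sup>2 * det (bungee_deriv x)"
    by simp
qed simp

lemma bungee_map_quasiconformal: "quasiconformal bungee_map"
  unfolding quasiconformal_def
proof (intro conjI exI bungee_map_quasiregular)
  \<comment> \<open>The inverse runs the recursion backwards: \<open>x n\<close> is recovered from
    \<open>x (Suc n)\<close> and \<open>x (Suc (Suc n))\<close>.\<close>
  define g :: "real^2 \<Rightarrow> real^2"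
    where "g y = vector [37/6 * triangle_wave (y $ 1) - y $ 2, y $ 1]" for y
  have tw: "continuous_on UNIV triangle_wave"
    unfolding triangle_wave_def by (intro continuous_intros)
  have "continuous_on UNIV g"
    unfolding continuous_on_componentwise[of UNIV g] g_def
    by (auto simp: Basis_vec_def inner_axis forall_2 intro!: continuous_intros continuous_on_compose2[OF tw])
  moreover have "continuous_on UNIV bungee_map"
    using bungee_map_lipschitz by (rule lipschitz_on_continuous_on)
  ultimately show "homeomorphism UNIV UNIV bungee_map g"
    by (intro homeomorphismI) (auto simp: g_def bungee_map_def vec_eq_iff forall_2)
qed

subsection \<open>An oscillating orbit\<close>

text \<open>Hyperbolicity: the influence of past and future forcing decays geometrically, so bounded
  forcing has a bounded response. The bound \<open>1/4\<close> keeps that response in the linear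
  range of the wave.\<close>

lemma bounded_solution_exists:
  fixes a :: "nat \<Rightarrow> real"
  assumes a: "\<And>n. \<bar>a n\<bar> \<le> 1"
  obtains \<epsilon> where "\<And>n. \<bar>\<epsilon> n\<bar> \<le> 1/4"
    and "\<And>n. \<epsilon> (Suc (Suc n)) + \<epsilon> n = 37/6 * \<epsilon> (Suc n) - a (Suc n)"
proof -
  \<comment> \<open>The past: \<open>P n\<close> is the sum of \<open>(1/6)^(n - k) * a k\<close>
    over \<open>k < n\<close>.\<close>
  define P where "P = rec_nat 0 (\<lambda>n p. (p + a n) / 6)"
  have P: "P 0 = 0" "P (Suc n) = (P n + a n) / 6" for n
    by (simp_all add: P_def)
  \<comment> \<open>\<open>1/5\<close> is the fixed point of
    \<open>p \<mapsto> (p + 1) / 6\<close>.\<close>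
  have P_bound: "\<bar>P n\<bar> \<le> 1/5" for n
  proof (induction n)
    case (Suc n)
    then show ?case using a[of n] abs_triangle_ineq[of "P n" "a n"] unfolding P(2) by simp
  qed (simp add: P)
  \<comment> \<open>The present and future: weights \<open>(1/6)^k\<close>, with the term
    \<open>a n\<close> included here and not in \<open>P n\<close>.\<close>
  define F where "F n = (\<Sum>k. (1/6)^k * a (n + k))" for n
  have term_bound: "norm ((1/6)^k * a (n + k)) \<le> (1/6)^k" for n k
    using a[of "n + k"] by (simp add: abs_mult mult_left_le)
  have geo: "(\<lambda>k. (1/6::real)^k) sums (6/5)"
    using geometric_sums[of "1/6::real"] by simp
  have smm: "summable (\<lambda>k. (1/6)^k * a (n + k))" for n
    using sums_summable[OF geo] by (rule summable_comparison_test') (rule term_bound)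
  have F: "F n = a n + F (Suc n) / 6" for n
  proof -
    have "F n = (\<Sum>k. (1/6)^(Suc k) * a (n + Suc k)) + a n"
      unfolding F_def using suminf_split_head[OF smm[of n]] by simp
    also have "(\<Sum>k. (1/6)^(Suc k) * a (n + Suc k)) = (\<Sum>k. 1/6 * ((1/6)^k * a (Suc n + k)))"
      by (simp add: mult.assoc)
    also have "\<dots> = 1/6 * F (Suc n)"
      unfolding F_def using smm by (rule suminf_mult)
    finally show ?thesis by simp
  qed
  have F_bound: "\<bar>F n\<bar> \<le> 6/5" for n
  proof -
    have "norm (F n) \<le> (\<Sum>k. (1/6)^k)"
      unfolding F_def using term_bound sums_summable[OF geo] by (rule norm_suminf_le)
    then show ?thesis
      using sums_unique[OF geo] by simp
  qed
  \<comment> \<open>convolution of \<open>a\<close> with the Green's function \<open>(6/35) (1/6)\<^sup>|\<^sup>n\<^sup>|\<close> of the recursion,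
    whose characteristic roots are \<open>6\<close> and \<open>1/6\<close>\<close>
  define \<epsilon> where "\<epsilon> n = 6/35 * (P n + F n)" for n
  show thesis
  proof
    show "\<bar>\<epsilon> n\<bar> \<le> 1/4" for n
      \<comment> \<open>The bounds give \<open>6/35 * (1/5 + 6/5) = 6/25\<close>, just below
        \<open>1/4\<close>.\<close>
      using P_bound[of n] F_bound[of n] abs_triangle_ineq[of "P n" "F n"] unfolding \<epsilon>_def abs_mult by simp
    \<comment> \<open>The terms in \<open>a n\<close> from \<open>P\<close> and \<open>F\<close>
      cancel; \<open>(1/6 - 6) * a (Suc n)\<close> remains, which the factor \<open>6/35\<close>
      normalises to \<open>- a (Suc n)\<close>.\<close>
    show "\<epsilon> (Suc (Suc n)) + \<epsilon> n = 37/6 * \<epsilon> (Suc n) - a (Suc n)" for n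
      using F[of n] F[of "Suc n"] P(2)[of n] P(2)[of "Suc n"] unfolding \<epsilon>_def by (simp add: field_simps)
  qed
qed

text \<open>The distance to the set of powers of \<open>4\<close> is 1-Lipschitz, vanishes on that
  set and is unbounded along its gaps. Rounding down keeps unit steps within
  \<open>1\<close>.\<close>

lemma oscillating_integer_walk_exists:
  obtains s :: "nat \<Rightarrow> int" where "\<And>j. \<bar>s (Suc j) - s j\<bar> \<le> 1"
    and "\<And>k. s (4 ^ k) = 0" and "\<And>k. s (2 * 4 ^ k) \<ge> 4 ^ k"
proof -
  define S :: "real set" where "S = range (\<lambda>k. 4 ^ k)"
  define s where "s j = \<lfloor>infdist (real j) S\<rfloor>" for j
  show thesis
  proof
    show "\<bar>s (Suc j) - s j\<bar> \<le> 1" for j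
      using infdist_triangle_abs[of "real (Suc j)" S "real j"]
      unfolding s_def dist_real_def abs_le_iff by linarith
    show "s (4 ^ k) = 0" for k
      by (simp add: s_def S_def)
    show "s (2 * 4 ^ k) \<ge> 4 ^ k" for k
    proof -
      \<comment> \<open>The closest power of \<open>4\<close> is \<open>4 ^ k\<close>; the next one
        up is \<open>2 * 4 ^ k\<close> away.\<close>
      have "4 ^ k \<le> dist (2 * 4 ^ k :: real) (4 ^ i)" for i
      proof (cases "i \<le> k")
        case True
        then have "(4::real) ^ i \<le> 4 ^ k" by (intro power_increasing) auto
        then show ?thesis unfolding dist_real_def by linarith
      next
        case False
        then have "(4::real) ^ Suc k \<le> 4 ^ i" by (intro power_increasing) auto
        then show ?thesis unfolding dist_real_def by simp
      qed
      then have "4 ^ k \<le> infdist (2 * 4 ^ k) S"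
        unfolding S_def by (subst infdist_notempty) (auto intro!: cINF_greatest)
      then show ?thesis
        unfolding s_def by (simp add: le_floor_iff)
    qed
  qed
qed

text \<open>Smallness is claimed at two consecutive times because a point of the planar orbit is a
  pair of consecutive terms.\<close>

lemma bungee_orbit_exists:
  obtains x :: "nat \<Rightarrow> real"
  where "\<And>n. x (Suc (Suc n)) = 37/6 * triangle_wave (x (Suc n)) - x n"
    and "\<And>k. \<bar>x (4 * 4 ^ k)\<bar> \<ge> 4 ^ k - 1/4"
    and "\<And>k. \<bar>x (2 * 4 ^ k)\<bar> \<le> 1/4" and "\<And>k. \<bar>x (Suc (2 * 4 ^ k))\<bar> \<le> 1/4"
proof -
  obtain s :: "nat \<Rightarrow> int" where s: "\<And>j. \<bar>s (Suc j) - s j\<bar> \<le> 1"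
    "\<And>k. s (4 ^ k) = 0" "\<And>k. s (2 * 4 ^ k) \<ge> 4 ^ k"
    using oscillating_integer_walk_exists by blast
  \<comment> \<open>the rotation \<open>m (n + 2) = - m n\<close> with kicks of size at most \<open>1\<close>, which are steps of \<open>s\<close>\<close>
  define m :: "nat \<Rightarrow> real"
    where "m n = (if even n then (-1) ^ (n div 2) * of_int (s (n div 2)) else 0)" for n
  have m_Ints: "m n \<in> \<int>" for n
    by (simp add: m_def)
  \<comment> \<open>Shifted by one, so that \<open>a (Suc n)\<close> is the kick from
    \<open>m n\<close> to \<open>m (Suc (Suc n))\<close>. The value \<open>a 0\<close> occurs in no
    equation of the recursion; \<open>0\<close> respects the bound.\<close>
  define a where "a n = (case n of 0 \<Rightarrow> 0 | Suc k \<Rightarrow> m (Suc (Suc k)) + m k)" for n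
  have "\<bar>m (Suc (Suc n)) + m n\<bar> \<le> 1" for n
  proof (cases "even n")
    case True
    then have "m (Suc (Suc n)) + m n = - ((-1) ^ (n div 2) * of_int (s (Suc (n div 2)) - s (n div 2)))"
      by (simp add: m_def algebra_simps)
    then have "\<bar>m (Suc (Suc n)) + m n\<bar> = of_int \<bar>s (Suc (n div 2)) - s (n div 2)\<bar>"
      by (simp add: abs_mult power_abs)
    then show ?thesis
      using s(1)[of "n div 2"] by linarith
  qed (simp add: m_def)
  then have "\<bar>a n\<bar> \<le> 1" for n
    by (simp add: a_def split: nat.split)
  then obtain \<epsilon> where \<epsilon>: "\<And>n. \<bar>\<epsilon> n\<bar> \<le> 1/4"
    "\<And>n. \<epsilon> (Suc (Suc n)) + \<epsilon> n = 37/6 * \<epsilon> (Suc n) - a (Suc n)"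
    using bounded_solution_exists[of a] by blast
  show thesis
  proof (rule that[of "\<lambda>n. m n + \<epsilon> n"])
    show "m (Suc (Suc n)) + \<epsilon> (Suc (Suc n)) =
        37/6 * triangle_wave (m (Suc n) + \<epsilon> (Suc n)) - (m n + \<epsilon> n)" for n
      using \<epsilon>(2)[of n] unfolding triangle_wave_near_Ints[OF m_Ints \<epsilon>(1)] by (simp add: a_def)
    show "\<bar>m (4 * 4 ^ k) + \<epsilon> (4 * 4 ^ k)\<bar> \<ge> 4 ^ k - 1/4" for k
    proof -
      have "\<bar>m (4 * 4 ^ k)\<bar> = of_int \<bar>s (2 * 4 ^ k)\<bar>"
        by (simp add: m_def abs_mult power_abs)
      moreover have "(4::real) ^ k \<le> of_int (s (2 * 4 ^ k))"
        using s(3)[of k] by (metis of_int_le_iff of_int_numeral of_int_power)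
      ultimately show ?thesis
        using \<epsilon>(1)[of "4 * 4 ^ k"] by linarith
    qed
    show "\<bar>m (2 * 4 ^ k) + \<epsilon> (2 * 4 ^ k)\<bar> \<le> 1/4" for k
      using \<epsilon>(1)[of "2 * 4 ^ k"] by (simp add: m_def s(2))
    show "\<bar>m (Suc (2 * 4 ^ k)) + \<epsilon> (Suc (2 * 4 ^ k))\<bar> \<le> 1/4" for k
      using \<epsilon>(1)[of "Suc (2 * 4 ^ k)"] by (simp add: m_def)
  qed
qed

text \<open>At times \<open>4 * 4 ^ k\<close> the first coordinate is unboundedly large, while at
  times \<open>2 * 4 ^ k\<close> the orbit is back within distance \<open>1/2\<close> of the
  origin.\<close>

lemma bungee_set_bungee_map: "bungee_set bungee_map \<noteq> {}"
proof -
  obtain x :: "nat \<Rightarrow> real"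
    where x: "\<And>n. x (Suc (Suc n)) = 37/6 * triangle_wave (x (Suc n)) - x n"
      and large: "\<And>k. \<bar>x (4 * 4 ^ k)\<bar> \<ge> 4 ^ k - 1/4"
      and small: "\<And>k. \<bar>x (2 * 4 ^ k)\<bar> \<le> 1/4" "\<And>k. \<bar>x (Suc (2 * 4 ^ k))\<bar> \<le> 1/4"
    using bungee_orbit_exists by blast
  define p :: "real^2" where "p = vector [x 0, x 1]"
  have orbit: "(bungee_map ^^ n) p = vector [x n, x (Suc n)]" for n
    by (induction n) (simp_all add: p_def bungee_map_def x)
  have "\<not> bounded (range (\<lambda>n. (bungee_map ^^ n) p))"
  proof
    assume "bounded (range (\<lambda>n. (bungee_map ^^ n) p))"
    then obtain B where B: "\<And>n. norm ((bungee_map ^^ n) p) \<le> B"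
      unfolding bounded_iff by auto
    obtain k where "B + 1/4 < 4 ^ k"
      using real_arch_pow[of 4 "B + 1/4"] by auto
    moreover have "\<bar>x (4 * 4 ^ k)\<bar> \<le> B"
      using component_le_norm_cart[of "(bungee_map ^^ (4 * 4 ^ k)) p" 1] B[of "4 * 4 ^ k"]
      by (simp add: orbit)
    ultimately show False
      using large[of k] by linarith
  qed
  moreover have "\<not> filterlim (\<lambda>n. (bungee_map ^^ n) p) at_infinity sequentially"
  proof
    assume "filterlim (\<lambda>n. (bungee_map ^^ n) p) at_infinity sequentially"
    then have "\<forall>\<^sub>F n in sequentially. 1 \<le> norm ((bungee_map ^^ n) p)"
      by (simp add: filterlim_at_infinity[of 0])
    then obtain N where N: "\<And>n. n \<ge> N \<Longrightarrow> 1 \<le> norm ((bungee_map ^^ n) p)"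
      unfolding eventually_sequentially by blast
    \<comment> \<open>Makes \<open>2 * 4 ^ N\<close> a return time beyond \<open>N\<close>.\<close>
    have "N < 4 ^ N" by (rule less_exp[of N, THEN order_less_le_trans]) (simp add: power_mono)
    then have "1 \<le> norm ((bungee_map ^^ (2 * 4 ^ N)) p)"
      by (intro N) simp
    also have "\<dots> \<le> \<bar>x (2 * 4 ^ N)\<bar> + \<bar>x (Suc (2 * 4 ^ N))\<bar>"
      using norm_le_l1_cart[of "(bungee_map ^^ (2 * 4 ^ N)) p"] by (simp add: sum_2 orbit)
    finally show False
      using small[of N] by linarith
  qed
  ultimately show ?thesis
    unfolding bungee_set_def by blast
qed

theorem theorem4: "\<exists>f :: real^2 \<Rightarrow> real^2. quasiconformal f \<and> bungee_set f \<noteq> {}"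
  using bungee_map_quasiconformal bungee_set_bungee_map by blast

end
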